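(* For unfolding angles $98.195^\circ\le\alpha\le108^\circ$, one has $\pi_0(A_{PF})\cap\pi_1(A_{PF})=\{P_{1,1}\}$.
   Context: The plane is identified with $\mathbb{C}$; angles are measured counterclockwise, in degrees ($e^{i\theta}$ denotes the unit vector with polar angle $\theta$). For an unfolding angle $90^\circ\le\alpha\le108^\circ$ put $\beta=90^\circ-\frac{\alpha}{2}$ and $q=\frac{1}{2\cos\beta}$. Let $P_{0,0}=0$, $P_{0,1}=1$, $P_{1,1}=q e^{-i\beta}$. Mappings: $\pi_0(z)=q e^{-i\beta}z$ (rotation about $P_{0,0}$ by $-\beta$ and dilation by $q$) and $\pi_1(z)=1+q e^{i(\beta-180^\circ)}z=1-q e^{i\beta}z$ (rotation about $P_{0,0}$ by $\beta-180^\circ$, dilation by $q$, then translation by $\overrightarrow{P_{0,0}P_{0,1}}$). Spiral functions: $a_0(\varphi)=\frac{1}{1-q^4}q^{-\varphi/\beta}$, $b_0(\varphi)=\left(1-\frac{q^2}{1-q^4}\right)q^{-\varphi/\beta}$, $c_0(\varphi)=\frac{1}{1-q^4}q^{-(\varphi+\alpha)/\beta}$, $d_0(\varphi)=\left(1-\frac{q^2}{1-q^4}\right)q^{-(\varphi+\alpha)/\beta}$, $e_0(\varphi)=\frac{1}{1-q^4}q^{-(\varphi-4\beta)/\beta}$. Here $\varphi$ is a real polar angle (in degrees, not reduced modulo $360^\circ$). Define $S_1=\{P_{0,0}+d e^{i\varphi} : \varphi\le-\beta,\ b_0(\varphi)\le d\le a_0(\varphi)\}$, $S_2=\{P_{0,0}+d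 e^{i\varphi} : -\beta\le\varphi\le0^\circ,\ b_0(\varphi)\le d\le q\}$, $S_3=\{P_{0,1}+d e^{i\varphi} : \varphi\le-\alpha-\beta,\ d_0(\varphi)\le d\le c_0(\varphi)\}$, $S_4=\{P_{1,1}+d e^{i\varphi} : -\beta\le\varphi\le\beta,\ 0\le d\le e_0(\varphi)\}$, and $A_{PF}=S_1\cup S_2\cup S_3\cup S_4\cup\{P_{0,0},P_{0,1}\}$ (the spiral centres $P_{0,0},P_{0,1}$ are included). *)

theory Defs
  imports Complex_Main
begin

text \<open>
  All angles, including the unfolding angle \<open>\<alpha>\<close>, are real numbers measured in degrees.
  Polar angles \<open>\<phi>\<close> are not reduced modulo 360: the spiral functions depend on the
  representative, so the spiral regions below are unions over all admissible real \<open>\<phi>\<close>.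
\<close>

definition rad :: "real \<Rightarrow> real" where
  "rad \<theta> = \<theta> * pi / 180"

definition edeg :: "real \<Rightarrow> complex" where
  "edeg \<theta> = cis (rad \<theta>)"

definition bet :: "real \<Rightarrow> real" where
  "bet \<alpha> = 90 - \<alpha> / 2"

definition qf :: "real \<Rightarrow> real" where
  "qf \<alpha> = 1 / (2 * cos (rad (bet \<alpha>)))"

definition P00 :: complex where "P00 = 0"

definition P01 :: complex where "P01 = 1"

definition P11 :: "real \<Rightarrow> complex" where
  "P11 \<alpha> = of_real (qf \<alpha>) * edeg (- bet \<alpha>)"

definition pi0 :: "real \<Rightarrow> complex \<Rightarrow> complex" where
  "pi0 \<alpha> z = of_real (qf \<alpha>) * edeg (- bet \<alpha>) * z"

definition pi1 :: "real \<Rightarrow> complex \<Rightarrow> complex" where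
  "pi1 \<alpha> z = 1 + of_real (qf \<alpha>) * edeg (bet \<alpha> - 180) * z"

definition a0 :: "real \<Rightarrow> real \<Rightarrow> real" where
  "a0 \<alpha> \<phi> = 1 / (1 - qf \<alpha> ^ 4) * qf \<alpha> powr (- \<phi> / bet \<alpha>)"

definition b0 :: "real \<Rightarrow> real \<Rightarrow> real" where
  "b0 \<alpha> \<phi> = (1 - qf \<alpha> ^ 2 / (1 - qf \<alpha> ^ 4)) * qf \<alpha> powr (- \<phi> / bet \<alpha>)"

definition c0 :: "real \<Rightarrow> real \<Rightarrow> real" where
  "c0 \<alpha> \<phi> = 1 / (1 - qf \<alpha> ^ 4) * qf \<alpha> powr (- (\<phi> + \<alpha>) / bet \<alpha>)"

definition d0 :: "real \<Rightarrow> real \<Rightarrow> real" where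
  "d0 \<alpha> \<phi> = (1 - qf \<alpha> ^ 2 / (1 - qf \<alpha> ^ 4)) * qf \<alpha> powr (- (\<phi> + \<alpha>) / bet \<alpha>)"

definition e0 :: "real \<Rightarrow> real \<Rightarrow> real" where
  "e0 \<alpha> \<phi> = 1 / (1 - qf \<alpha> ^ 4) * qf \<alpha> powr (- (\<phi> - 4 * bet \<alpha>) / bet \<alpha>)"

definition S1 :: "real \<Rightarrow> complex set" where
  "S1 \<alpha> = {P00 + of_real d * edeg \<phi> | d \<phi>.
     \<phi> \<le> - bet \<alpha> \<and> b0 \<alpha> \<phi> \<le> d \<and> d \<le> a0 \<alpha> \<phi>}"

definition S2 :: "real \<Rightarrow> complex set" where
  "S2 \<alpha> = {P00 + of_real d * edeg \<phi> | d \<phi>.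
     - bet \<alpha> \<le> \<phi> \<and> \<phi> \<le> 0 \<and> b0 \<alpha> \<phi> \<le> d \<and> d \<le> qf \<alpha>}"

definition S3 :: "real \<Rightarrow> complex set" where
  "S3 \<alpha> = {P01 + of_real d * edeg \<phi> | d \<phi>.
     \<phi> \<le> - \<alpha> - bet \<alpha> \<and> d0 \<alpha> \<phi> \<le> d \<and> d \<le> c0 \<alpha> \<phi>}"

definition S4 :: "real \<Rightarrow> complex set" where
  "S4 \<alpha> = {P11 \<alpha> + of_real d * edeg \<phi> | d \<phi>.
     - bet \<alpha> \<le> \<phi> \<and> \<phi> \<le> bet \<alpha> \<and> 0 \<le> d \<and> d \<le> e0 \<alpha> \<phi>}"

definition APF :: "real \<Rightarrow> complex set" where
  "APF \<alpha> = S1 \<alpha> \<union> S2 \<alpha> \<union> S3 \<alpha> \<union> S4 \<alpha> \<union> {P00, P01}"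

end

theory Submission
  imports Defs "HOL-Analysis.Complex_Transcendental"
begin

text \<open>
  The equation \<open>pi0 a = pi1 b\<close> says that \<open>a\<close> is the image of \<open>b\<close> under the rotation about \<open>1\<close> by
  \<open>-\<alpha>\<close>, so the claim is that \<open>APF\<close> meets its rotated copy only in \<open>1\<close>. It suffices that every
  circle about \<open>1\<close> meets \<open>APF\<close> in an arc of angle less than \<open>\<alpha>\<close>, because \<open>2\<alpha> < 360\<close>. Close to \<open>1\<close>
  this arc is cut out by the logarithmic spirals bounding \<open>S3\<close>; the only other parts of \<open>APF\<close> there
  are portions of \<open>S2\<close> and \<open>S4\<close>, which lie in the continuation of the same spiral band.
\<close>

section \<open>Polar angles in degrees and polar coordinates about \<open>1\<close>\<close>

lemma edeg_add: "edeg (x + y) = edeg x * edeg y"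
  by (simp add: edeg_def rad_def cis_mult add_divide_distrib distrib_right)

lemma edeg_minus_180: "edeg (x - 180) = - edeg x"
  by (simp add: edeg_def rad_def diff_divide_distrib left_diff_distrib complex_eq_iff)

lemma norm_edeg [simp]: "norm (edeg x) = 1"
  by (simp add: edeg_def)

lemma Re_edeg [simp]: "Re (edeg x) = cos (rad x)"
  and Im_edeg [simp]: "Im (edeg x) = sin (rad x)"
  by (simp_all add: edeg_def)

lemma rad_mono_iff: "rad x \<le> rad y \<longleftrightarrow> x \<le> y"
  by (simp add: rad_def field_simps)

lemma rad_simps: "rad (x + y) = rad x + rad y" "rad (x - y) = rad x - rad y"
  "rad (- x) = - rad x" "rad (2 * x) = 2 * rad x" "rad 0 = 0" "rad 90 = pi / 2" "rad 180 = pi"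
  by (simp_all add: rad_def add_divide_distrib diff_divide_distrib algebra_simps)

lemma edeg_eq_imp:
  assumes "edeg x = edeg y"
  obtains k :: int where "x = y + 360 * k"
proof -
  have "sin (rad x) = sin (rad y) \<and> cos (rad x) = cos (rad y)"
    using assms by (simp add: edeg_def complex_eq_iff)
  then obtain k :: int where "rad x = rad y + 2 * pi * k"
    by (subst (asm) sin_cos_eq_iff) auto
  then have "x * pi = (y + 360 * k) * pi"
    by (simp add: rad_def field_simps)
  then show thesis
    using that by simp
qed

lemma rad_le_iffs:
  "0 \<le> rad x \<longleftrightarrow> 0 \<le> x" "rad x \<le> pi \<longleftrightarrow> x \<le> 180"
  "rad x \<le> pi / 2 \<longleftrightarrow> x \<le> 90" "- (pi / 2) \<le> rad x \<longleftrightarrow> -90 \<le> x" "pi / 2 \<le> rad x \<longleftrightarrow> 90 \<le> x"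
  using rad_mono_iff[of 0 x] rad_mono_iff[of x 180] rad_mono_iff[of x 90]
    rad_mono_iff[of "-90" x] rad_mono_iff[of 90 x]
  by (simp_all add: rad_simps)

lemma sin_rad_nonneg: "0 \<le> x \<Longrightarrow> x \<le> 180 \<Longrightarrow> 0 \<le> sin (rad x)"
  by (intro sin_ge_zero) (simp_all add: rad_le_iffs)

lemma cos_rad_nonneg: "-90 \<le> x \<Longrightarrow> x \<le> 90 \<Longrightarrow> 0 \<le> cos (rad x)"
  by (intro cos_ge_zero) (simp_all only: rad_le_iffs)

lemma cos_rad_nonpos: "90 \<le> x \<Longrightarrow> x \<le> 180 \<Longrightarrow> cos (rad x) \<le> 0"
  using cos_monotone_0_pi_le[of "pi / 2" "rad x"] by (simp only: rad_le_iffs) simp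

lemma sin_rad_le_iff:
  assumes "-90 \<le> x" "x \<le> 90" "-90 \<le> y" "y \<le> 90"
  shows "sin (rad x) \<le> sin (rad y) \<longleftrightarrow> x \<le> y"
  using assms by (subst sin_mono_le_eq) (simp_all only: rad_le_iffs rad_mono_iff)

lemma sin_rad_le_cancel:
  assumes "sin (rad x) \<le> sin (rad y)" "-90 \<le> x" "x \<le> 90" "-90 \<le> y" "y \<le> 90"
  shows "x \<le> y"
  using assms sin_rad_le_iff by blast

text \<open>Taking the direction of \<open>1 - z\<close> rather than \<open>z - 1\<close> keeps the
  angle between -90 and 90, where angles can be compared through their sines.\<close>

lemma polar_about_1:
  assumes "Re z < 1"
  obtains d \<theta> where "d > 0" "-90 < \<theta>" "\<theta> < 90" "1 - z = of_real d * edeg \<theta>"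
proof -
  have re: "Re (1 - z) > 0" and nz: "1 - z \<noteq> 0"
    using assms by auto
  have *: "\<bar>Arg (1 - z)\<bar> < pi / 2"
    using re nz Arg_Re_pos by blast
  define \<theta> where "\<theta> = Arg (1 - z) * 180 / pi"
  have r: "rad \<theta> = Arg (1 - z)"
    by (simp add: \<theta>_def rad_def)
  have "1 - z = of_real (norm (1 - z)) * edeg \<theta>"
    unfolding edeg_def r using rcis_cmod_Arg[of "1 - z"] by (simp add: rcis_def)
  moreover have "-90 < \<theta>" "\<theta> < 90"
    using * by (simp_all add: \<theta>_def abs_less_iff field_simps)
  ultimately show thesis
    using that[of "norm (1 - z)" \<theta>] nz by simp
qed

text \<open>The point \<open>z\<close> lies on the line through \<open>1\<close> with direction
  \<open>\<theta>\<close>, and this line has distance \<open>\<bar>sin (rad \<theta>)\<bar>\<close>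
  from \<open>0\<close>.\<close>

lemma abs_sin_le_norm:
  assumes "1 - z = of_real d * edeg \<theta>"
  shows "\<bar>sin (rad \<theta>)\<bar> \<le> norm z"
proof -
  have "z = 1 - of_real d * edeg \<theta>"
    using assms by (metis diff_diff_eq2 add_diff_cancel_left')
  then have "Re z = 1 - d * cos (rad \<theta>)" "Im z = - d * sin (rad \<theta>)"
    by simp_all
  then have "(norm z)\<^sup>2 = (1 - d * cos (rad \<theta>))\<^sup>2 + (d * sin (rad \<theta>))\<^sup>2"
    by (simp add: cmod_power2)
  also have "\<dots> = (sin (rad \<theta>))\<^sup>2 + (d - cos (rad \<theta>))\<^sup>2"
    using sin_cos_squared_add[of "rad \<theta>"] by algebra
  finally have "(sin (rad \<theta>))\<^sup>2 \<le> (norm z)\<^sup>2"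
    by simp
  then show ?thesis
    by (simp add: abs_le_square_iff[symmetric])
qed

text \<open>The logarithmic spiral \<open>exp (k t) cis t\<close> stays on one side of its tangent line at \<open>t = 0\<close>.\<close>

lemma spiral_tangent:
  fixes k t :: real
  assumes "0 \<le> t" "t \<le> pi"
  shows "exp (k * t) * (cos t - k * sin t) \<le> 1"
proof -
  let ?f = "\<lambda>t. exp (k * t) * (cos t - k * sin t)"
  have "?f t \<le> ?f 0"
  proof (rule DERIV_nonpos_imp_nonincreasing[OF assms(1)])
    fix x assume x: "0 \<le> x" "x \<le> t"
    have "(?f has_real_derivative - (1 + k\<^sup>2) * exp (k * x) * sin x) (at x)"
      by (auto intro!: derivative_eq_intros simp: algebra_simps power2_eq_square)
    moreover have "0 \<le> sin x"
      using x assms by (intro sin_ge_zero) auto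
    then have "0 \<le> (1 + k\<^sup>2) * exp (k * x) * sin x"
      by (intro mult_nonneg_nonneg) auto
    then have "- (1 + k\<^sup>2) * exp (k * x) * sin x \<le> 0"
      by (simp only: mult_minus_left neg_le_0_iff_le)
    ultimately show "\<exists>y. (?f has_real_derivative y) (at x) \<and> y \<le> 0"
      by blast
  qed
  then show ?thesis by simp
qed

text \<open>Seen from \<open>1\<close>, the disc of radius 1/4 about \<open>0\<close> thus lies
  within 15 degrees of the direction of \<open>0\<close>.\<close>

lemma sin_rad_15: "1 / 4 < sin (rad 15)"
proof -
  have "2 * rad 15 = pi / 6"
    by (simp add: rad_def)
  then have "cos (2 * rad 15) = sqrt 3 / 2"
    by (simp only: cos_30)
  then have "1 - 2 * (sin (rad 15))\<^sup>2 = sqrt 3 / 2"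
    by (simp add: cos_double_sin)
  moreover have "sqrt 3 < 7 / 4"
    by (rule real_less_lsqrt) (auto simp: power2_eq_square)
  ultimately have "(1 / 4)\<^sup>2 < (sin (rad 15))\<^sup>2"
    by (simp add: power2_eq_square)
  moreover have "0 \<le> sin (rad 15)"
    by (rule sin_rad_nonneg) auto
  ultimately show ?thesis
    by (rule power2_less_imp_less)
qed

section \<open>Numerical bounds in the range of unfolding angles\<close>

locale unfolding_angle =
  fixes \<alpha> :: real
  assumes angle_ge: "98.195 \<le> \<alpha>" and angle_le: "\<alpha> \<le> 108"
begin

abbreviation "\<beta> \<equiv> bet \<alpha>"
abbreviation "q \<equiv> qf \<alpha>"
text \<open>\<open>A\<close> and \<open>B\<close> are the amplitudes of the outer and inner spirals;
  \<open>T\<close> is the outer one after a turn by \<open>-2 * \<beta>\<close>.\<close>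

definition "A = 1 / (1 - q ^ 4)"
definition "T = q\<^sup>2 / (1 - q ^ 4)"
definition "B = 1 - T"

lemma spiral_eqs:
  "a0 \<alpha> \<phi> = A * q powr (- \<phi> / \<beta>)"
  "b0 \<alpha> \<phi> = B * q powr (- \<phi> / \<beta>)"
  "c0 \<alpha> \<phi> = A * q powr (- (\<phi> + \<alpha>) / \<beta>)"
  "d0 \<alpha> \<phi> = B * q powr (- (\<phi> + \<alpha>) / \<beta>)"
  "e0 \<alpha> \<phi> = A * q powr (- (\<phi> - 4 * \<beta>) / \<beta>)"
  by (simp_all only: a0_def b0_def c0_def d0_def e0_def A_def B_def T_def)

lemma beta_bounds: "36 \<le> \<beta>" "\<beta> \<le> 40.9025" "\<alpha> = 180 - 2 * \<beta>"
  using angle_ge angle_le by (auto simp: bet_def)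

lemma sin_beta_pos: "0 < sin (rad \<beta>)"
  using beta_bounds sin_rad_le_iff[of \<beta> 0] by (simp add: rad_simps)

lemma cos_beta_pos: "0 < cos (rad \<beta>)"
  using beta_bounds sin_rad_le_iff[of "90 - \<beta>" 0] by (simp add: rad_simps sin_diff)

lemma q_pos: "0 < q"
  using cos_beta_pos by (simp add: qf_def)

lemma q_cos: "2 * q * cos (rad \<beta>) = 1"
  using cos_beta_pos by (simp add: qf_def)

lemma q_sq_bounds: "0.38 \<le> q\<^sup>2" "q\<^sup>2 \<le> 0.437625"
proof -
  \<comment> \<open>Twice \<open>\<beta>\<close> is the complement of this small angle, so
    \<open>q ^ 2 = 1 / (2 * (1 + sin y))\<close> and bounds on \<open>sin y\<close> suffice.\<close>
  define y where "y = rad (\<alpha> - 90)"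
  have y: "8.195 * pi / 180 \<le> y" "y \<le> 18 * pi / 180"
    using angle_ge angle_le by (auto simp: y_def rad_def field_simps)
  have pi: "3.1415 \<le> pi" "pi \<le> 3.142"
    using pi_approx by (auto simp: abs_le_iff)
  have "2 * rad \<beta> = pi / 2 - y"
    by (simp add: y_def rad_def bet_def field_simps)
  then have "sin y = cos (2 * rad \<beta>)"
    by (simp add: cos_diff)
  then have "4 * (cos (rad \<beta>))\<^sup>2 = 2 * (1 + sin y)"
    by (simp add: cos_double_cos)
  then have eq: "q\<^sup>2 * (2 * (1 + sin y)) = 1"
    using q_cos by algebra
  \<comment> \<open>This is \<open>8.195 * 3.1415 / 180\<close>, rounded down.\<close>
  let ?y0 = "0.143025 :: real"
  have "8.195 * 3.1415 \<le> 8.195 * pi"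
    using pi by simp
  then have y': "?y0 \<le> y" "y \<le> 0.3142"
    using y pi by auto
  have "sin y \<le> 0.3142"
    using sin_x_le_x[of y] y' by simp
  then have "q\<^sup>2 * (2 * (1 + sin y)) \<le> q\<^sup>2 * (2 * 1.3142)"
    by (intro mult_left_mono) auto
  then show "0.38 \<le> q\<^sup>2"
    using eq by simp
  have "0.142535 \<le> sin ?y0"
    using abs_le_D2[OF Maclaurin_sin_bound[of ?y0 5]]
    by (simp add: lessThan_nat_numeral sin_coeff_def fact_numeral power_divide)
  also have "sin ?y0 \<le> sin y"
    using y' pi by (intro sin_monotone_2pi_le) auto
  finally have "0.142535 \<le> sin y" .
  then have "q\<^sup>2 * (2 * 1.142535) \<le> q\<^sup>2 * (2 * (1 + sin y))"
    by (intro mult_left_mono) auto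
  then show "q\<^sup>2 \<le> 0.437625"
    using eq by simp
qed

lemma q_bounds: "0.616 \<le> q" "q \<le> 0.6616"
proof -
  show "0.616 \<le> q"
    by (rule power2_le_imp_le) (use q_sq_bounds q_pos in \<open>auto simp: power2_eq_square\<close>)
  show "q \<le> 0.6616"
    by (rule power2_le_imp_le) (use q_sq_bounds q_pos in \<open>auto simp: power2_eq_square\<close>)
qed

lemma q_4: "q ^ 4 = (q\<^sup>2)\<^sup>2"
  by simp

lemma q_4_bounds: "0.1444 \<le> q ^ 4" "q ^ 4 \<le> 0.1916"
proof -
  have "0.38\<^sup>2 \<le> (q\<^sup>2)\<^sup>2" "(q\<^sup>2)\<^sup>2 \<le> 0.437625\<^sup>2"
    using q_sq_bounds by (intro power_mono; simp)+
  then show "0.1444 \<le> q ^ 4" "q ^ 4 \<le> 0.1916"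
    unfolding q_4 by (simp_all add: power_divide)
qed

lemma T_bounds: "0.444 \<le> T" "T \<le> 0.5416"
  using q_sq_bounds q_4_bounds by (auto simp: T_def field_simps)

text \<open>From \<open>q * cos (rad \<beta>) = 1 / 2\<close>, the square of
  \<open>q * sin (rad \<beta>)\<close> is \<open>q ^ 2 - 1 / 4\<close>; this is compared with the
  upper bound 0.5416 for \<open>T\<close>.\<close>

lemma T_less_sin_beta: "T < sin (rad \<beta>)"
proof -
  have "(q * sin (rad \<beta>))\<^sup>2 = q\<^sup>2 - 1 / 4"
    using q_cos sin_cos_squared_add[of "rad \<beta>"] by algebra
  moreover have "(0.5416 * q)\<^sup>2 < q\<^sup>2 - 1 / 4"
    using q_sq_bounds by (simp add: power_mult_distrib power_divide)
  ultimately have "0.5416 * q < q * sin (rad \<beta>)"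
    using power2_less_imp_less[of "0.5416 * q" "q * sin (rad \<beta>)"] q_pos sin_beta_pos by simp
  then have "0.5416 < sin (rad \<beta>)"
    using q_pos by (simp add: mult.commute)
  then show ?thesis
    using T_bounds by linarith
qed

lemma A_pos: "0 < A"
  using q_4_bounds by (simp add: A_def)

lemma A_mult_q_sq: "A * q\<^sup>2 = T"
  by (simp add: A_def T_def)

lemma B_eq: "B = A * (1 - q\<^sup>2 - q ^ 4)"
  using q_4_bounds by (simp add: A_def B_def T_def field_simps)

text \<open>
  The only sharp estimate: it fails for \<open>\<alpha> = 98.194\<close>, and at \<open>98.195\<close> the relative slack is about
  \<open>7 / 10 ^ 5\<close>. It says that \<open>S3\<close> and its rotation by \<open>-\<alpha>\<close> about \<open>1\<close> are disjoint.
\<close>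

lemma spiral_gap: "q powr (\<alpha> / \<beta>) < 1 - q\<^sup>2 - q ^ 4"
proof -
  let ?P = "0.437625 :: real"
  \<comment> \<open>The exponent equals \<open>180 / \<beta> - 2\<close>, which is least at
    \<open>\<beta> = 40.9025\<close>, that is at \<open>\<alpha> = 98.195\<close>.\<close>
  have exp_ge: "2.4007 \<le> \<alpha> / \<beta>"
    using beta_bounds by (simp add: field_simps)
  have "ln q = ln (q\<^sup>2) / 2"
    using q_pos by (simp add: ln_realpow)
  also have "\<dots> \<le> ln ?P / 2"
    using q_sq_bounds q_pos by simp
  finally have lnq: "ln q \<le> ln ?P / 2" .
  \<comment> \<open>A coarse bound on \<open>ln ?P\<close> is enough: it only multiplies the excess
    of 2.4007 over 2.4, and \<open>0.0007 / 2 * 0.8 = 0.00028\<close>.\<close>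
  have "exp (0.05 :: real) \<le> 1 + 0.05 + 0.05\<^sup>2"
    by (rule exp_bound) auto
  then have "exp (0.05 :: real) ^ 16 \<le> 1.0525 ^ 16"
    by (intro power_mono) (auto simp: power2_eq_square)
  then have "exp (0.8 :: real) \<le> 1.0525 ^ 16"
    by (simp add: exp_of_nat_mult[symmetric])
  also have "\<dots> \<le> 1 / ?P"
    by (simp add: power_divide)
  finally have "exp (0.8 :: real) * ?P \<le> 1"
    by simp
  then have "?P \<le> exp (- 0.8)"
    by (simp add: exp_minus field_simps)
  then have "ln ?P \<le> ln (exp (- 0.8))"
    by (subst ln_le_cancel_iff) auto
  then have lnP: "ln ?P \<le> - 0.8"
    by simp
  have "q powr (\<alpha> / \<beta>) = exp (\<alpha> / \<beta> * ln q)"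
    using q_pos by (simp add: powr_def)
  also have "\<dots> \<le> exp (1.2 * ln ?P - 0.00028)"
  proof -
    have "\<alpha> / \<beta> * ln q \<le> \<alpha> / \<beta> * (ln ?P / 2)"
      using beta_bounds lnq by (intro mult_left_mono) auto
    also have "\<dots> \<le> 2.4007 * (ln ?P / 2)"
      using exp_ge lnP by (intro mult_right_mono_neg) linarith+
    also have "\<dots> \<le> 1.2 * ln ?P - 0.00028"
      using lnP by simp
    finally show ?thesis by simp
  qed
  also have "\<dots> < 1 - ?P - ?P\<^sup>2"
  proof -
    \<comment> \<open>\<open>?R\<close> is \<open>?P\<close> to the power 6/5, rounded up; comparing
      \<open>?P ^ 6\<close> with \<open>?R ^ 5\<close> avoids the root.\<close>
    let ?R = "0.370957 :: real"
    have "6 * ln ?P = ln (?P ^ 6)"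
      by (simp add: ln_realpow)
    also have "\<dots> \<le> ln (?R ^ 5)"
      by (subst ln_le_cancel_iff) (auto simp: power_divide)
    also have "\<dots> = 5 * ln ?R"
      by (simp add: ln_realpow)
    finally have "1.2 * ln ?P \<le> ln ?R"
      by simp
    then have "exp (1.2 * ln ?P - 0.00028) \<le> exp (ln ?R - 0.00028)"
      by simp
    also have "\<dots> = ?R / exp 0.00028"
      by (simp only: exp_diff) simp
    also have "\<dots> \<le> ?R / (1 + 0.00028)"
      by (intro divide_left_mono exp_ge_add_one_self) auto
    also have "\<dots> < 1 - ?P - ?P\<^sup>2"
      by (simp add: power2_eq_square)
    finally show ?thesis .
  qed
  also have "\<dots> \<le> 1 - q\<^sup>2 - q ^ 4"
  proof -
    have "q ^ 4 \<le> ?P\<^sup>2"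
      unfolding q_4 using q_sq_bounds by (intro power_mono) auto
    then show ?thesis using q_sq_bounds by simp
  qed
  finally show ?thesis .
qed

section \<open>Spiral bands about \<open>1\<close> and their angular width\<close>

lemma spiral_shift:
  "c0 \<alpha> (\<theta> - 180) = T * q powr (- \<theta> / \<beta>)" (is ?c)
  "d0 \<alpha> (\<theta> - 180) = B * q\<^sup>2 * q powr (- \<theta> / \<beta>)" (is ?d)
proof -
  \<comment> \<open>The direction from \<open>1\<close> to \<open>0\<close> is represented by -180,
    and \<open>180 - \<alpha> = 2 * \<beta>\<close> produces the factor
    \<open>q ^ 2\<close>.\<close>
  have "- (\<theta> - 180 + \<alpha>) / \<beta> = 2 + - \<theta> / \<beta>"
    using beta_bounds by (simp add: field_simps)
  then have "q powr (- (\<theta> - 180 + \<alpha>) / \<beta>) = q\<^sup>2 * q powr (- \<theta> / \<beta>)"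
    using q_pos by (simp only: powr_add) simp
  then show ?c ?d
    by (simp_all add: spiral_eqs A_mult_q_sq[symmetric])
qed

lemma q_powr_mono: "x \<le> y \<Longrightarrow> q powr y \<le> q powr x"
  using q_pos q_bounds by (intro powr_mono') auto

lemma B_pos: "0 < B"
  using T_bounds by (simp add: B_def)

text \<open>
  Radius \<open>d\<close> and angle \<open>\<phi>\<close> of a point in polar coordinates about \<open>1\<close>: close to \<open>1\<close> the point has to lie
  in the unbounded continuation of the band \<open>S3\<close>, further out in a fixed sector. The radius \<open>T\<close> is
  where the outer boundary of \<open>S3\<close> meets the segment from \<open>0\<close> to \<open>1\<close>.
\<close>

definition admissible :: "real \<Rightarrow> real \<Rightarrow> bool" where
  "admissible d \<phi> \<longleftrightarrow>
     (if d < T then d0 \<alpha> \<phi> \<le> d \<and> d \<le> c0 \<alpha> \<phi> else -195 \<le> \<phi> \<and> \<phi> \<le> 2 * \<beta> - 180)"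

text \<open>Both spirals grow with the angle. If \<open>\<phi>\<close> exceeded
  \<open>\<psi>\<close> by \<open>\<alpha>\<close> or more, the inner spiral at
  \<open>\<phi>\<close> would by \<open>spiral_gap\<close> lie beyond the outer one at
  \<open>\<psi>\<close>, leaving no common radius.\<close>

lemma admissible_angle_diff:
  assumes "admissible d \<phi>" "admissible d \<psi>"
  shows "\<phi> - \<psi> < \<alpha>"
proof (cases "d < T")
  case True
  let ?x = "- (\<phi> + \<alpha>) / \<beta>" and ?y = "- (\<psi> + \<alpha>) / \<beta>"
  have "d0 \<alpha> \<phi> \<le> c0 \<alpha> \<psi>"
    using True assms by (simp add: admissible_def)
  then have "A * ((1 - q\<^sup>2 - q ^ 4) * q powr ?x) \<le> A * q powr ?y"
    unfolding spiral_eqs B_eq by (simp only: mult.assoc)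
  then have *: "(1 - q\<^sup>2 - q ^ 4) * q powr ?x \<le> q powr ?y"
    by (rule mult_left_le_imp_le) (rule A_pos)
  have "q powr (\<alpha> / \<beta> + ?x) = q powr (\<alpha> / \<beta>) * q powr ?x"
    by (rule powr_add)
  also have "\<dots> < (1 - q\<^sup>2 - q ^ 4) * q powr ?x"
    using spiral_gap q_pos by (intro mult_strict_right_mono) auto
  finally have "q powr (\<alpha> / \<beta> + ?x) < q powr ?y"
    using * by simp
  then have "?y < \<alpha> / \<beta> + ?x"
    using q_powr_mono[of "\<alpha> / \<beta> + ?x" ?y] by linarith
  then have "\<phi> * \<beta> < (\<alpha> + \<psi>) * \<beta>"
    using beta_bounds by (simp add: field_simps)
  then show ?thesis
    using beta_bounds by simp
next
  \<comment> \<open>The sector has width \<open>2 * \<beta> + 15\<close>, at most 96.805, which is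
    below \<open>\<alpha>\<close>.\<close>
  case False
  then show ?thesis
    using assms beta_bounds by (simp add: admissible_def)
qed

definition separated :: "complex \<Rightarrow> bool" where
  "separated z \<longleftrightarrow> (\<exists>d \<phi>. d > 0 \<and> z = 1 + of_real d * edeg \<phi> \<and> admissible d \<phi>)"

lemma separatedI:
  assumes "1 - z = of_real d * edeg \<theta>" "d > 0" "admissible d (\<theta> - 180)"
  shows "separated z"
proof -
  have "z = 1 - (1 - z)"
    by simp
  also have "\<dots> = 1 + of_real d * edeg (\<theta> - 180)"
    unfolding edeg_minus_180 assms(1) by simp
  finally show ?thesis
    unfolding separated_def using assms by blast
qed

text \<open>On this range of angles the outer bound holds for every radius below \<open>T\<close>,
  so only the inner bound needs checking.\<close>

lemma c0_large: "0 \<le> \<theta> \<Longrightarrow> T \<le> c0 \<alpha> (\<theta> - 180)"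
proof -
  assume "0 \<le> \<theta>"
  then have "q powr 0 \<le> q powr (- \<theta> / \<beta>)"
    using beta_bounds by (intro q_powr_mono) simp
  then have "T * 1 \<le> T * q powr (- \<theta> / \<beta>)"
    using T_bounds q_pos by (intro mult_left_mono) auto
  then show ?thesis
    by (simp add: spiral_shift)
qed

section \<open>Locating each piece of \<open>APF\<close> about \<open>1\<close>\<close>

lemma separated_0: "separated 0"
  by (rule separatedI[of 0 1 0])
    (use T_bounds beta_bounds in \<open>auto simp: edeg_def rad_simps admissible_def\<close>)

lemma separated_S3:
  assumes "z \<in> S3 \<alpha>"
  shows "separated z"
proof -
  obtain d \<phi> where z: "z = 1 + of_real d * edeg \<phi>" and \<phi>: "\<phi> \<le> - \<alpha> - \<beta>"
    and d: "d0 \<alpha> \<phi> \<le> d" "d \<le> c0 \<alpha> \<phi>"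
    using assms by (auto simp: S3_def P01_def)
  have "0 < d0 \<alpha> \<phi>"
    unfolding spiral_eqs using B_pos q_pos by (intro mult_pos_pos) auto
  then have "0 < d"
    using d by simp
  moreover have "admissible d \<phi>"
  proof (cases "d < T")
    case False
    \<comment> \<open>For angles below -180 the outer spiral has already dropped under
      \<open>T\<close>.\<close>
    have "-180 \<le> \<phi>"
    proof (rule ccontr)
      assume "\<not> -180 \<le> \<phi>"
      then have "0 < - (\<phi> + 180) / \<beta>"
        using beta_bounds by (intro divide_pos_pos) auto
      then have "q powr (- (\<phi> + 180) / \<beta>) < q powr 0"
        using q_pos q_bounds by (intro powr_less_mono') auto
      then have "T * q powr (- (\<phi> + 180) / \<beta>) < T * 1"
        using T_bounds q_pos by (intro mult_strict_left_mono) auto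
      then show False
        using spiral_shift(1)[of "\<phi> + 180"] d False by simp
    qed
    then show ?thesis
      using False \<phi> beta_bounds by (simp add: admissible_def)
  qed (use d in \<open>simp add: admissible_def\<close>)
  ultimately show ?thesis
    unfolding separated_def using z by blast
qed

lemma sin_2_beta: "sin (rad (2 * \<beta>)) = sin (rad \<beta>) / q"
proof -
  have "q * sin (rad (2 * \<beta>)) = (2 * q * cos (rad \<beta>)) * sin (rad \<beta>)"
    unfolding rad_simps sin_double by simp
  then show ?thesis
    unfolding q_cos using q_pos by (simp add: field_simps)
qed

lemma sin_polar:
  assumes "1 - z = of_real d * edeg \<theta>"
  shows "d * sin (rad \<theta>) = - Im z"
  using arg_cong[OF assms, of Im] by simp

lemma theta_nonneg:
  assumes "1 - z = of_real d * edeg \<theta>" "d > 0" "-90 < \<theta>" "\<theta> < 90" "Im z \<le> 0"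
  shows "0 \<le> \<theta>"
proof -
  have "0 \<le> d * sin (rad \<theta>)"
    using sin_polar assms by simp
  then have "sin (rad 0) \<le> sin (rad \<theta>)"
    using assms by (simp add: rad_simps zero_le_mult_iff)
  then show ?thesis
    by (rule sin_rad_le_cancel) (use assms in auto)
qed

text \<open>This piece stays at distance at least \<open>T\<close> from \<open>1\<close>, so only
  the sector condition matters. The windings from -180 on lie in a small disc about
  \<open>0\<close>; the rest lies in the lower half plane.\<close>

lemma separated_S1:
  assumes "z \<in> S1 \<alpha>"
  shows "separated z"
proof -
  obtain \<rho> \<phi> where z: "z = of_real \<rho> * edeg \<phi>" and \<phi>: "\<phi> \<le> - \<beta>"
    and \<rho>: "b0 \<alpha> \<phi> \<le> \<rho>" "\<rho> \<le> a0 \<alpha> \<phi>"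
    using assms by (auto simp: S1_def P00_def)
  have "0 < b0 \<alpha> \<phi>"
    unfolding spiral_eqs using B_pos q_pos by (intro mult_pos_pos) auto
  then have \<rho>_pos: "0 < \<rho>"
    using \<rho> by simp
  then have nz: "norm z = \<rho>"
    by (simp add: z norm_mult)
  have "q powr (- \<phi> / \<beta>) \<le> q powr 1"
    using \<phi> beta_bounds by (intro q_powr_mono) (simp add: field_simps)
  then have "q powr (- \<phi> / \<beta>) \<le> q"
    using q_pos by simp
  then have "a0 \<alpha> \<phi> \<le> A * q"
    unfolding spiral_eqs using A_pos by (intro mult_left_mono) auto
  also have "\<dots> = T / q"
    using q_pos by (simp add: A_mult_q_sq[symmetric] power2_eq_square)
  finally have \<rho>_le: "\<rho> \<le> T / q"
    using \<rho> by simp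
  also have "T / q < 1"
    using T_bounds q_bounds q_pos by simp
  finally have "Re z < 1"
    using nz complex_Re_le_cmod[of z] by simp
  then obtain d \<theta> where d: "d > 0" "-90 < \<theta>" "\<theta> < 90" and pol: "1 - z = of_real d * edeg \<theta>"
    by (rule polar_about_1)
  have d_norm: "d = norm (1 - z)"
    using d by (simp add: pol norm_mult)
  have sin_le: "\<bar>sin (rad \<theta>)\<bar> \<le> \<rho>"
    using abs_sin_le_norm[OF pol] nz by simp
  have "T \<le> d \<and> -15 \<le> \<theta> \<and> \<theta> \<le> 2 * \<beta>"
  proof (cases "\<phi> \<le> -180")
    case True
    \<comment> \<open>The exponent \<open>2 + \<alpha> / \<beta>\<close> is
      \<open>180 / \<beta>\<close>, which lets \<open>spiral_gap\<close> bound the radius by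
      \<open>q ^ 2 * B\<close>.\<close>
    have "q powr (- \<phi> / \<beta>) \<le> q powr (2 + \<alpha> / \<beta>)"
      using True beta_bounds by (intro q_powr_mono) (simp add: field_simps)
    also have "\<dots> = q\<^sup>2 * q powr (\<alpha> / \<beta>)"
      using q_pos by (simp add: powr_add)
    also have "\<dots> \<le> q\<^sup>2 * (1 - q\<^sup>2 - q ^ 4)"
      using spiral_gap by (intro mult_left_mono) auto
    finally have "a0 \<alpha> \<phi> \<le> A * (q\<^sup>2 * (1 - q\<^sup>2 - q ^ 4))"
      unfolding spiral_eqs using A_pos by (intro mult_left_mono) auto
    also have "\<dots> = q\<^sup>2 * B"
      unfolding B_eq by simp
    also have "\<dots> \<le> 0.437625 * 0.556"
      using q_sq_bounds T_bounds by (intro mult_mono) (auto simp: B_def)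
    finally have small: "\<rho> \<le> 1 / 4"
      using \<rho> by simp
    have "sin (rad \<theta>) \<le> sin (rad 15)" "sin (rad (-15)) \<le> sin (rad \<theta>)"
      using small sin_le sin_rad_15 by (simp_all add: rad_simps abs_le_iff)
    then have "\<theta> \<le> 15" "-15 \<le> \<theta>"
      using d by (auto dest!: sin_rad_le_cancel)
    moreover have "T \<le> d"
      using norm_triangle_ineq2[of 1 z] small T_bounds nz by (simp add: d_norm)
    ultimately show ?thesis
      using beta_bounds by simp
  next
    case False
    have "0 \<le> sin (rad (- \<phi>))"
      using False \<phi> beta_bounds by (intro sin_rad_nonneg) auto
    then have "Im z \<le> 0"
      using \<rho>_pos by (simp add: z rad_simps mult_nonneg_nonpos)
    then have "0 \<le> \<theta>"
      using theta_nonneg[OF pol] d by simp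
    moreover have "\<theta> \<le> 2 * \<beta>"
    proof (rule sin_rad_le_cancel)
      show "sin (rad \<theta>) \<le> sin (rad (2 * \<beta>))"
      proof -
        have "T / q \<le> sin (rad \<beta>) / q"
          using T_less_sin_beta q_pos by (intro divide_right_mono) auto
        then show ?thesis
          unfolding sin_2_beta using sin_le \<rho>_le by linarith
      qed
    qed (use d beta_bounds in auto)
    moreover have "T \<le> d"
    proof (cases "\<phi> \<le> -90")
      case True
      have "cos (rad (-\<phi>)) \<le> 0"
        using True False by (intro cos_rad_nonpos) auto
      then have "Re z \<le> 0"
        using \<rho>_pos by (simp add: z rad_simps mult_nonneg_nonpos)
      then have "1 \<le> d"
        using complex_Re_le_cmod[of "1 - z"] by (simp add: d_norm)
      then show ?thesis
        using T_bounds by simp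
    next
      case False
      \<comment> \<open>With \<open>0\<close> and \<open>1\<close> exchanged in
        \<open>abs_sin_le_norm\<close>, the distance from \<open>1\<close> to the ray through
        \<open>z\<close> bounds \<open>d\<close> from below.\<close>
      have "sin (rad \<beta>) \<le> sin (rad (- \<phi>))"
        using False \<phi> beta_bounds
        by (subst sin_rad_le_iff) auto
      also have "\<dots> \<le> norm (1 - z)"
        using abs_sin_le_norm[of "1 - z" \<rho> \<phi>] z by (simp add: rad_simps)
      finally show ?thesis
        using T_less_sin_beta by (simp add: d_norm)
    qed
    ultimately show ?thesis by simp
  qed
  then show ?thesis
    by (intro separatedI[OF pol d(1)]) (auto simp: admissible_def)
qed

text \<open>The circular sector of radius \<open>q\<close> lies in the triangle with vertices
  \<open>0\<close>, \<open>1\<close> and \<open>P11 \<alpha>\<close>, and has distance at least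
  \<open>1 - q\<close> from \<open>1\<close>, which exceeds the inner spiral at these
  angles.\<close>

lemma separated_S2:
  assumes "z \<in> S2 \<alpha>"
  shows "separated z"
proof -
  obtain \<rho> \<phi> where z: "z = of_real \<rho> * edeg \<phi>" and \<phi>: "- \<beta> \<le> \<phi>" "\<phi> \<le> 0"
    and \<rho>: "b0 \<alpha> \<phi> \<le> \<rho>" "\<rho> \<le> q"
    using assms by (auto simp: S2_def P00_def)
  have "0 < b0 \<alpha> \<phi>"
    unfolding spiral_eqs using B_pos q_pos by (intro mult_pos_pos) auto
  then have \<rho>_pos: "0 < \<rho>"
    using \<rho> by simp
  then have nz: "norm z = \<rho>"
    by (simp add: z norm_mult)
  then have "Re z < 1"
    using \<rho> q_bounds complex_Re_le_cmod[of z] by simp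
  then obtain d \<theta> where d: "d > 0" "-90 < \<theta>" "\<theta> < 90" and pol: "1 - z = of_real d * edeg \<theta>"
    by (rule polar_about_1)
  have "0 \<le> sin (rad (- \<phi>))"
    using \<phi> beta_bounds by (intro sin_rad_nonneg) auto
  then have "Im z \<le> 0"
    using \<rho>_pos by (simp add: z rad_simps mult_nonneg_nonpos)
  then have \<theta>_ge: "0 \<le> \<theta>"
    using theta_nonneg[OF pol] d by simp
  have \<theta>_le: "\<theta> \<le> \<beta>"
  proof -
    \<comment> \<open>Equality with \<open>sin (rad \<beta>)\<close> describes the line through
      \<open>1\<close> and \<open>P11 \<alpha>\<close>; the inequality places \<open>z\<close> on
      the side of \<open>0\<close>.\<close>
    have "\<rho> * sin (rad (\<beta> - \<phi>)) \<le> q * sin (rad (2 * \<beta>))"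
    proof (rule mult_mono)
      show "sin (rad (\<beta> - \<phi>)) \<le> sin (rad (2 * \<beta>))"
        using \<phi> beta_bounds by (subst sin_rad_le_iff) auto
      show "0 \<le> sin (rad (\<beta> - \<phi>))"
        using \<phi> beta_bounds by (intro sin_rad_nonneg) auto
    qed (use \<rho> q_pos in auto)
    also have "\<dots> = sin (rad \<beta>)"
      using q_pos by (simp add: sin_2_beta)
    finally have *: "\<rho> * sin (rad \<beta> - rad \<phi>) \<le> sin (rad \<beta>)"
      by (simp add: rad_simps)
    have re: "d * cos (rad \<theta>) = 1 - \<rho> * cos (rad \<phi>)" and im: "d * sin (rad \<theta>) = - (\<rho> * sin (rad \<phi>))"
      using arg_cong[OF pol, of Re] arg_cong[OF pol, of Im] by (simp_all add: z)
    have "d * sin (rad \<beta> - rad \<theta>) =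
        sin (rad \<beta>) * (d * cos (rad \<theta>)) - cos (rad \<beta>) * (d * sin (rad \<theta>))"
      by (simp add: sin_diff algebra_simps)
    also have "\<dots> = sin (rad \<beta>) - \<rho> * sin (rad \<beta> - rad \<phi>)"
      unfolding re im by (simp add: sin_diff algebra_simps)
    finally have "0 \<le> d * sin (rad \<beta> - rad \<theta>)"
      using * by simp
    then have "0 \<le> sin (rad (\<beta> - \<theta>))"
      using d(1) by (simp add: rad_simps zero_le_mult_iff)
    then have "sin (rad 0) \<le> sin (rad (\<beta> - \<theta>))"
      by (simp add: rad_simps)
    then have "0 \<le> \<beta> - \<theta>"
      by (rule sin_rad_le_cancel) (use d beta_bounds \<theta>_ge in auto)
    then show ?thesis by simp
  qed
  have "d0 \<alpha> (\<theta> - 180) \<le> d"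
  proof -
    have "q powr (- \<theta> / \<beta>) \<le> q powr (- 1)"
      using \<theta>_le beta_bounds by (intro q_powr_mono) (simp add: field_simps)
    then have "d0 \<alpha> (\<theta> - 180) \<le> B * q\<^sup>2 * q powr (- 1)"
      unfolding spiral_shift using B_pos by (intro mult_left_mono) auto
    also have "\<dots> = q * (1 - T)"
      using q_pos by (simp add: powr_minus power2_eq_square B_def)
    also have "\<dots> \<le> 1 - q"
    \<comment> \<open>The claim is \<open>q * (2 - T) \<le> 1\<close>. As \<open>T\<close> grows
      with \<open>q\<close>, the global bounds are too weak together, but suffice on each of the two
      ranges.\<close>
    proof (cases "q \<le> 0.64")
      case True
      then have "q * (2 - T) \<le> 0.64 * (2 - 0.444)"
        using T_bounds q_pos by (intro mult_mono) auto
      then show ?thesis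
        by (simp add: algebra_simps)
    next
      case False
      then have "0.64\<^sup>2 \<le> q\<^sup>2"
        by (intro power_mono) auto
      then have q2: "0.4096 \<le> q\<^sup>2"
        by (simp add: power2_eq_square)
      then have "0.4096\<^sup>2 \<le> q ^ 4"
        unfolding q_4 by (intro power_mono) auto
      then have "0.492 \<le> T"
        using q2 q_4_bounds by (simp add: T_def field_simps power2_eq_square)
      then have "q * (2 - T) \<le> 0.6616 * (2 - 0.492)"
        using T_bounds q_pos q_bounds by (intro mult_mono) auto
      then show ?thesis
        by (simp add: algebra_simps)
    qed
    also have "\<dots> \<le> d"
    proof -
      have "d = norm (1 - z)"
        using d by (simp add: pol norm_mult)
      then show ?thesis
        using norm_triangle_ineq2[of 1 z] nz \<rho> by simp
    qed
    finally show ?thesis .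
  qed
  then have "admissible d (\<theta> - 180)"
    using c0_large[OF \<theta>_ge] \<theta>_ge \<theta>_le beta_bounds by (simp add: admissible_def)
  then show ?thesis
    by (intro separatedI[OF pol d(1)])
qed

text \<open>The points \<open>0\<close>, \<open>1\<close> and \<open>P11 \<alpha>\<close> form an
  isosceles triangle with base angles \<open>\<beta>\<close> and legs \<open>q\<close>.\<close>

lemma P11_eq: "P11 \<alpha> = 1 - of_real q * edeg \<beta>"
  using q_cos by (simp add: P11_def complex_eq_iff rad_simps)

lemma separated_S4:
  assumes "z \<in> S4 \<alpha>"
  shows "separated z"
proof -
  obtain \<rho> \<phi> where z: "z = P11 \<alpha> + of_real \<rho> * edeg \<phi>" and \<phi>: "- \<beta> \<le> \<phi>" "\<phi> \<le> \<beta>"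
    and \<rho>: "0 \<le> \<rho>" "\<rho> \<le> e0 \<alpha> \<phi>"
    using assms by (auto simp: S4_def)
  \<comment> \<open>The similarity fixing \<open>1\<close> that rotates by \<open>\<beta>\<close>
    and scales by \<open>q\<close> sends \<open>0\<close> to \<open>P11 \<alpha>\<close> and
    \<open>v\<close> to \<open>z\<close>; working with \<open>v\<close> moves the apex of the piece
    to \<open>0\<close>.\<close>
  define r \<psi> where "r = \<rho> / q" and "\<psi> = \<beta> - \<phi>"
  define v where "v = of_real r * edeg (- \<psi>)"
  have \<psi>: "0 \<le> \<psi>" "\<psi> \<le> 2 * \<beta>"
    using \<phi> by (auto simp: \<psi>_def)
  have "- (\<phi> - 4 * \<beta>) / \<beta> = 3 + \<psi> / \<beta>"
    using beta_bounds by (simp add: \<psi>_def field_simps)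
  then have "e0 \<alpha> \<phi> = A * (q ^ 3 * q powr (\<psi> / \<beta>))"
    unfolding spiral_eqs using q_pos by (simp only: powr_add) simp
  also have "\<dots> = q * (T * q powr (\<psi> / \<beta>))"
    by (simp add: A_mult_q_sq[symmetric] power2_eq_square power3_eq_cube)
  finally have r_le: "0 \<le> r" "r \<le> T * q powr (\<psi> / \<beta>)"
    using \<rho> q_pos by (auto simp: r_def field_simps)
  have "q powr (\<psi> / \<beta>) \<le> q powr 0"
    using \<psi> beta_bounds by (intro q_powr_mono) simp
  then have "T * q powr (\<psi> / \<beta>) \<le> T * 1"
    using T_bounds q_pos by (intro mult_left_mono) auto
  then have r_T: "r \<le> T"
    using r_le by simp
  have nv: "norm v = r"
    using r_le by (simp add: v_def norm_mult)
  then have "Re v < 1"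
    using r_T T_bounds complex_Re_le_cmod[of v] by simp
  then obtain D \<theta> where D: "D > 0" "-90 < \<theta>" "\<theta> < 90" and pol: "1 - v = of_real D * edeg \<theta>"
    by (rule polar_about_1)
  have "0 \<le> sin (rad \<psi>)"
    using \<psi> beta_bounds by (intro sin_rad_nonneg) auto
  then have "Im v \<le> 0"
    using r_le by (simp add: v_def rad_simps)
  then have \<theta>_ge: "0 \<le> \<theta>"
    using theta_nonneg[OF pol] D by simp
  have "sin (rad \<theta>) \<le> sin (rad \<beta>)"
    using abs_sin_le_norm[OF pol] nv r_T T_less_sin_beta by simp
  then have \<theta>_le: "\<theta> \<le> \<beta>"
    by (rule sin_rad_le_cancel) (use D beta_bounds in auto)
  have "1 - z = of_real q * (edeg \<beta> * (1 - v))"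
  proof -
    have "edeg \<phi> = edeg \<beta> * edeg (- \<psi>)"
      by (simp add: edeg_add[symmetric] \<psi>_def)
    then show ?thesis
      using q_pos by (simp add: z P11_eq v_def r_def field_simps)
  qed
  also have "\<dots> = of_real (q * D) * edeg (\<beta> + \<theta>)"
    by (simp add: pol edeg_add)
  finally have polz: "1 - z = of_real (q * D) * edeg (\<beta> + \<theta>)" .
  define k where "k = - ln q / rad \<beta>"
  have powr_k: "q powr (t / \<beta>) = exp (- k * rad t)" for t
    using q_pos beta_bounds by (simp add: powr_def k_def rad_def field_simps)
  have k_pos: "0 < k"
    unfolding k_def using q_pos q_bounds beta_bounds by (intro divide_pos_pos) (auto simp: rad_def)
  txt \<open>
    The sector \<open>S4\<close> and the inner spiral of \<open>S3\<close> touch at the tip of \<open>S4\<close>, and the line with normal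
    \<open>(1, - k)\<close> in the coordinates of \<open>1 - v\<close> is their common tangent there: they lie on opposite
    sides of it.
  \<close>
  have "r * (cos (rad \<psi>) + k * sin (rad \<psi>)) \<le> T"
  proof -
    have "0 \<le> cos (rad \<psi>)"
      using \<psi> beta_bounds by (intro cos_rad_nonneg) auto
    then have "r * (cos (rad \<psi>) + k * sin (rad \<psi>)) \<le>
        T * q powr (\<psi> / \<beta>) * (cos (rad \<psi>) + k * sin (rad \<psi>))"
      using r_le k_pos \<open>0 \<le> sin (rad \<psi>)\<close> by (intro mult_right_mono) auto
    also have "\<dots> = T * (exp (- k * rad \<psi>) * (cos (rad \<psi>) - (- k) * sin (rad \<psi>)))"
      by (simp add: powr_k)
    also have "\<dots> \<le> T * 1"
      using T_bounds \<psi> beta_bounds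
      by (intro mult_left_mono spiral_tangent) (auto simp: rad_le_iffs)
    finally show ?thesis by simp
  qed
  also have "r * (cos (rad \<psi>) + k * sin (rad \<psi>)) = 1 - D * (cos (rad \<theta>) - k * sin (rad \<theta>))"
  proof -
    have "D * cos (rad \<theta>) = 1 - r * cos (rad \<psi>)" "D * sin (rad \<theta>) = r * sin (rad \<psi>)"
      using arg_cong[OF pol, of Re] arg_cong[OF pol, of Im] by (simp_all add: v_def rad_simps)
    then show ?thesis by algebra
  qed
  finally have *: "B \<le> D * (cos (rad \<theta>) - k * sin (rad \<theta>))"
    by (simp add: B_def)
  have "B * q powr (- \<theta> / \<beta>) \<le> D"
  proof -
    \<comment> \<open>Here \<open>spiral_tangent\<close> with rate \<open>k\<close> turns the bound
      by the common tangent into the inner spiral bound.\<close>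
    have "B * exp (k * rad \<theta>) \<le> D * (cos (rad \<theta>) - k * sin (rad \<theta>)) * exp (k * rad \<theta>)"
      using * by (intro mult_right_mono) auto
    also have "\<dots> = D * (exp (k * rad \<theta>) * (cos (rad \<theta>) - k * sin (rad \<theta>)))"
      by simp
    also have "\<dots> \<le> D * 1"
      using D \<theta>_ge by (intro mult_left_mono spiral_tangent) (auto simp: rad_le_iffs)
    finally show ?thesis
      using powr_k[of "- \<theta>"] by (simp add: rad_simps)
  qed
  have "d0 \<alpha> (\<beta> + \<theta> - 180) = q * (B * q powr (- \<theta> / \<beta>))"
  proof -
    have "- (\<beta> + \<theta>) / \<beta> = - 1 + - \<theta> / \<beta>"
      using beta_bounds by (simp add: field_simps)
    then have "q powr (- (\<beta> + \<theta>) / \<beta>) = q powr (- \<theta> / \<beta>) / q"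
      using q_pos by (simp only: powr_add) (simp add: powr_minus field_simps)
    then show ?thesis
      unfolding spiral_shift using q_pos by (simp add: power2_eq_square)
  qed
  also have "\<dots> \<le> q * D"
    using \<open>B * q powr (- \<theta> / \<beta>) \<le> D\<close> q_pos by (intro mult_left_mono) auto
  finally have "admissible (q * D) (\<beta> + \<theta> - 180)"
    using c0_large[of "\<beta> + \<theta>"] \<theta>_ge \<theta>_le beta_bounds by (simp add: admissible_def)
  then show ?thesis
    by (intro separatedI[OF polz]) (use D q_pos in auto)
qed

section \<open>Combining the pieces with the rotation about \<open>1\<close>\<close>

lemma separated_APF:
  assumes "z \<in> APF \<alpha>" "z \<noteq> 1"
  shows "separated z"
  using assms separated_0 separated_S1 separated_S2 separated_S3 separated_S4
  by (auto simp: APF_def P00_def P01_def)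

text \<open>Both maps send \<open>1\<close> to \<open>P11 \<alpha>\<close>, and the quotient of
  their linear factors is \<open>- edeg (2 * \<beta>) = edeg (- \<alpha>)\<close>.\<close>

lemma pi0_eq_pi1_iff:
  "pi0 \<alpha> a = pi1 \<alpha> b \<longleftrightarrow> a - 1 = edeg (- \<alpha>) * (b - 1)"
proof -
  let ?w = "of_real q * edeg (- \<beta>)" and ?w' = "of_real q * edeg \<beta>"
  have w: "?w = 1 - ?w'"
    using P11_eq by (simp add: P11_def)
  have "- \<alpha> = 2 * \<beta> - 180"
    using beta_bounds by linarith
  then have "edeg (- \<alpha>) = edeg (2 * \<beta> - 180)"
    by (rule arg_cong)
  also have "\<dots> = - (edeg \<beta> * edeg \<beta>)"
    by (simp add: edeg_minus_180 edeg_add[symmetric])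
  finally have \<alpha>: "edeg (- \<alpha>) = - (edeg \<beta> * edeg \<beta>)" .
  have inv: "edeg (- \<beta>) * edeg \<beta> = 1"
    by (simp add: edeg_add[symmetric]) (simp add: edeg_def rad_simps)
  have "?w * (edeg (- \<alpha>) * (b - 1)) = - ?w' * (edeg (- \<beta>) * edeg \<beta>) * (b - 1)"
    unfolding \<alpha> by (simp add: algebra_simps)
  also have "\<dots> = pi1 \<alpha> b - ?w"
    unfolding w inv by (simp add: pi1_def edeg_minus_180 algebra_simps)
  finally have "pi1 \<alpha> b = ?w * (1 + edeg (- \<alpha>) * (b - 1))"
    by (simp add: algebra_simps)
  moreover have "?w \<noteq> 0"
    using q_pos by (simp add: edeg_def)
  ultimately have "pi0 \<alpha> a = pi1 \<alpha> b \<longleftrightarrow> a = 1 + edeg (- \<alpha>) * (b - 1)"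
    by (simp add: pi0_def)
  then show ?thesis
    by (auto simp: algebra_simps)
qed

lemma common_point:
  assumes "a \<in> APF \<alpha>" "b \<in> APF \<alpha>" "pi0 \<alpha> a = pi1 \<alpha> b"
  shows "a = 1"
proof (rule ccontr)
  assume "a \<noteq> 1"
  have eq: "a - 1 = edeg (- \<alpha>) * (b - 1)"
    using assms pi0_eq_pi1_iff by simp
  then have "b \<noteq> 1"
    using \<open>a \<noteq> 1\<close> by auto
  obtain d \<phi> where d: "d > 0" "a = 1 + of_real d * edeg \<phi>" "admissible d \<phi>"
    using separated_APF[OF assms(1) \<open>a \<noteq> 1\<close>] by (auto simp: separated_def)
  obtain e \<psi> where e: "e > 0" "b = 1 + of_real e * edeg \<psi>" "admissible e \<psi>"
    using separated_APF[OF assms(2) \<open>b \<noteq> 1\<close>] by (auto simp: separated_def)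
  have eq': "of_real d * edeg \<phi> = of_real e * edeg (\<psi> - \<alpha>)"
    using eq d e edeg_add[of \<psi> "- \<alpha>"] by (simp add: mult_ac)
  have "d = e"
    using d(1) e(1) arg_cong[OF eq', of norm] by (simp add: norm_mult)
  then have "edeg \<phi> = edeg (\<psi> - \<alpha>)"
    using eq' d by simp
  then obtain k :: int where k: "\<phi> = \<psi> - \<alpha> + 360 * k"
    by (rule edeg_eq_imp)
  have "\<phi> - \<psi> < \<alpha>" "\<psi> - \<phi> < \<alpha>"
    using d e \<open>d = e\<close> by (auto intro: admissible_angle_diff)
  \<comment> \<open>Here \<open>360 * k = \<phi> - \<psi> + \<alpha>\<close> lies strictly between 0
    and \<open>2 * \<alpha>\<close>, which is at most 216.\<close>
  then have "0 < 360 * k" "360 * k < 360"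
    using k angle_le by linarith+
  then show False
    by presburger
qed

end

theorem proposition3:
  fixes \<alpha> :: real
  assumes "98.195 \<le> \<alpha>" and "\<alpha> \<le> 108"
  shows "pi0 \<alpha> ` APF \<alpha> \<inter> pi1 \<alpha> ` APF \<alpha> = {P11 \<alpha>}"
proof -
  interpret unfolding_angle \<alpha>
    by unfold_locales (fact assms)+
  have 1: "1 \<in> APF \<alpha>"
    by (simp add: APF_def P01_def)
  have P11: "P11 \<alpha> = pi0 \<alpha> 1" "pi0 \<alpha> 1 = pi1 \<alpha> 1"
    by (simp_all add: pi0_eq_pi1_iff) (simp add: pi0_def P11_def)
  show ?thesis
  proof
    show "{P11 \<alpha>} \<subseteq> pi0 \<alpha> ` APF \<alpha> \<inter> pi1 \<alpha> ` APF \<alpha>"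
      using 1 P11 by (metis IntI empty_subsetI image_eqI insert_subset)
    show "pi0 \<alpha> ` APF \<alpha> \<inter> pi1 \<alpha> ` APF \<alpha> \<subseteq> {P11 \<alpha>}"
    proof
      fix x assume "x \<in> pi0 \<alpha> ` APF \<alpha> \<inter> pi1 \<alpha> ` APF \<alpha>"
      then obtain a b where "a \<in> APF \<alpha>" "b \<in> APF \<alpha>" "x = pi0 \<alpha> a" "x = pi1 \<alpha> b"
        by auto
      then show "x \<in> {P11 \<alpha>}"
        using common_point[of a b] P11 by simp
    qed
  qed
qed

end
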